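(* Let $(z,\alpha)$ be an S-pair and let $p\in K\setminus\alpha$ be an index such that $$n_p^TH_\alpha n_p<0\quad\text{and}\quad s_p(z)>0 .$$ Then the step procedure described in the context, started from $(z,\alpha)$ and $p$ (with step directions $d=H_{\alpha}n_p$ for the current active set), produces a new S-pair $(\bar z,\bar\alpha\cup\{p\})$ with $\bar\alpha\subseteq\alpha$ and $$f(\bar z)<f(z)$$ after $|\alpha|-|\bar\alpha|$ partial steps and one full step.
   Context: **Setting.** $f(z)=\tfrac12z^TGz+c^Tz$, $z=(x,y)\in\mathbb{R}^{n_x}\times\mathbb{R}^{n_y}$, $G=\begin{bmatrix} G_{11} & G_{12} \\ G_{12}^T & G_{22} \end{bmatrix}$ symmetric with $G_{22}$ negative definite; constraints $s(z)=Dz+h\le0$ with $D=[A\ \ B]$, $A\in\mathbb{R}^{m\times n_x}$, $B\in\mathbb{R}^{m\times n_y}$, $h\in\mathbb{R}^m$, $[m]=\{1,\dots,m\}$. Standing assumption: $G_{11}-G_{12}G_{22}^{-1}G_{12}^T\succ0$ (so $G$ is invertible). Write $g(z)=Gz+c$, $n_i=D_i^T$, $s_i(z)=n_i^Tz+h_i$, $N_\alpha=D_\alpha^T$ for $\alpha\subseteq[m]$, and $K=\{i\in[m]: n_i^TG^{-1}n_i<0\}$. **Operators.** $N_\alpha^*=(N_\alpha^TG^{-1}N_\alpha)^{-1}N_\alpha^TG^{-1}$, $H_\alpha=G^{-1}-G^{-1}N_\alpha(N_\alpha^TG^{-1}N_\alpha)^{-1}N_\alpha^TG^{-1}$ (with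 $H_\emptyset=G^{-1}$). Also $$\Gamma_\alpha=G_{11}-\begin{bmatrix} G_{12} & A_\alpha^T \end{bmatrix}\begin{bmatrix} G_{22} & B_\alpha^T \\ B_\alpha & 0 \end{bmatrix}^{-1}\begin{bmatrix} G_{12}^T \\ A_\alpha \end{bmatrix}$$ (writing $\Gamma_\alpha$ presupposes that the rows of $B_\alpha$ are linearly independent). **Local minimax point.** For $J\subseteq[m]$, $P(J)$ is the problem $\min_x\max_y f(z)$ s.t. $D_Jz+h_J\le0$. With $Y_J(x)=\{y: D_J(x,y)+h_J\le0\}$, a point $(x^*,y^* )$ with $y^*\in Y_J(x^* )$ is a local minimax point of $P(J)$ if there are $\delta_0>0$ and $\eta:(0,\delta_0]\to\mathbb{R}_+$ with $\eta(\delta)\to0$ as $\delta\to0$ such that for all $\delta\in(0,\delta_0]$, $x\in\mathbb{B}_\delta(x^* )$, $y\in Y_J(x^* )\cap\mathbb{B}_\delta(y^* )$: $f(x^*,y)\le f(x^*,y^* )\le\max\{f(x,\omega):\omega\in Y_J(x)\cap\mathbb{B}_{\eta(\delta)}(y^* )\}$. **S-pair.** $(z,\alpha)$ is an S-pair if $z$ is a local minimax point of $P(\alpha)$, $s_i(z)=0$ for all $i\in\alpha$, there are $\lambda_i\le0$ ($i\in\alpha$) with $Gz+c+\sum_{i\in\alpha}\lambda_in_i=0$, $\Gamma_\alpha\succ0$, and $\{D_i:i\in\alpha\}$ is linearly independent. Its multiplier vector is $u=-N_\alpha^*g(z)=(\lambda_i)_{i\in\alpha}\le0$. **Step procedure**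 from an S-pair $(z,\alpha)$ and index $p$. Put $n^+=n_p$, $u^+=(u,0)$ (entries indexed by $\alpha$ and then $p$). Repeat: compute $d=H_\alpha n^+$, $r=-N_\alpha^*n^+$; let $t_1=\min\{u_j^+/r_j: j\in\alpha,\ r_j<0\}$ ($=\infty$ if there is no such $j$), attained at $j=k$; let $t_2=\infty$ if $d^Tn^+\ge0$ and $t_2=-s_p(z)/(d^Tn^+)$ otherwise; $t=\min\{t_1,t_2\}$. If $t=\infty$, stop. Otherwise set $z\leftarrow z+td$, $u^+\leftarrow u^+-t\,(r,1)$. If $t=t_2$, this is a *full step*: set $\alpha\leftarrow\alpha\cup\{p\}$ and stop with the pair $(z,\alpha)$. Otherwise it is a *partial step*: set $\alpha\leftarrow\alpha\setminus\{k\}$, delete the $k$-th entry of $u^+$, and repeat. *)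

theory Defs
  imports "HOL-Analysis.Analysis"
begin

text \<open>
  A point \<open>z = (x, y)\<close> is a vector indexed by the sum type \<open>'x + 'y\<close>, so that \<open>G\<close> is a
  square matrix over that index type and \<open>D = [A B]\<close> has its columns indexed by it.

  An object indexed by a subset \<open>\<alpha>\<close> of the constraint index type (a row selection, an
  \<open>\<alpha> \<times> \<alpha>\<close> matrix, a multiplier vector) is represented over the full index type, with all
  entries outside \<open>\<alpha>\<close> equal to zero. Sums over the full type are then sums over \<open>\<alpha>\<close>, so that
  the products and differences below are those of the smaller matrices.
\<close>

section \<open>Block vectors and matrices\<close>

definition join :: "real^'x \<Rightarrow> real^'y \<Rightarrow> real^('x::finite + 'y::finite)" where
  "join x y = (\<chi> i. case i of Inl a \<Rightarrow> x $ a | Inr b \<Rightarrow> y $ b)"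

definition xpart :: "real^('x::finite + 'y::finite) \<Rightarrow> real^'x" where
  "xpart z = (\<chi> a. z $ Inl a)"

definition ypart :: "real^('x::finite + 'y::finite) \<Rightarrow> real^'y" where
  "ypart z = (\<chi> b. z $ Inr b)"

definition hblock :: "real^'a^'r \<Rightarrow> real^'b^'r \<Rightarrow> real^('a::finite + 'b::finite)^'r" where
  "hblock M N = (\<chi> i. join (M $ i) (N $ i))"

definition vblock :: "real^'c^'a \<Rightarrow> real^'c^'b \<Rightarrow> real^'c^('a::finite + 'b::finite)" where
  "vblock M N = (\<chi> i. case i of Inl a \<Rightarrow> M $ a | Inr b \<Rightarrow> N $ b)"

definition left_cols :: "real^('a::finite + 'b::finite)^'r \<Rightarrow> real^'a^'r" where
  "left_cols M = (\<chi> i. xpart (M $ i))"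

definition right_cols :: "real^('a::finite + 'b::finite)^'r \<Rightarrow> real^'b^'r" where
  "right_cols M = (\<chi> i. ypart (M $ i))"

definition blk11 :: "real^('x::finite + 'y::finite)^('x::finite + 'y::finite) \<Rightarrow> real^'x^'x" where
  "blk11 G = (\<chi> i j. G $ Inl i $ Inl j)"

definition blk12 :: "real^('x::finite + 'y::finite)^('x::finite + 'y::finite) \<Rightarrow> real^'y^'x" where
  "blk12 G = (\<chi> i j. G $ Inl i $ Inr j)"

definition blk22 :: "real^('x::finite + 'y::finite)^('x::finite + 'y::finite) \<Rightarrow> real^'y^'y" where
  "blk22 G = (\<chi> i j. G $ Inr i $ Inr j)"

definition pos_definite :: "real^'a^'a \<Rightarrow> bool" where
  "pos_definite M \<longleftrightarrow> transpose M = M \<and> (\<forall>v. v \<noteq> 0 \<longrightarrow> 0 < v \<bullet> (M *v v))"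

definition neg_definite :: "real^'a^'a \<Rightarrow> bool" where
  "neg_definite M \<longleftrightarrow> pos_definite (- M)"

section \<open>Matrices over a subset of the index type\<close>

definition sel_rows :: "'m set \<Rightarrow> real^'a^'m \<Rightarrow> real^'a^'m" where
  "sel_rows \<alpha> M = (\<chi> i. if i \<in> \<alpha> then M $ i else 0)"

definition id_on :: "'a set \<Rightarrow> real^'a^'a" where
  "id_on I = (\<chi> i j. if i = j \<and> i \<in> I then 1 else 0)"

text \<open>The inverse of an \<open>I \<times> I\<close> matrix; unspecified, like \<open>matrix_inv\<close>, if there is none.\<close>

definition inv_on :: "'a set \<Rightarrow> real^'a^'a \<Rightarrow> real^'a^'a" where
  "inv_on I M = (SOME X. (\<forall>i j. i \<notin> I \<or> j \<notin> I \<longrightarrow> X $ i $ j = 0) \<and>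
     M ** X = id_on I \<and> X ** M = id_on I)"

text \<open>Independence of the family \<open>(M $ i)\<close>, \<open>i \<in> \<alpha>\<close>: repeated rows count as dependent.\<close>

definition independent_rows :: "'m set \<Rightarrow> real^'a^'m \<Rightarrow> bool" where
  "independent_rows \<alpha> M \<longleftrightarrow> inj_on (\<lambda>i. M $ i) \<alpha> \<and> independent ((\<lambda>i. M $ i) ` \<alpha>)"

section \<open>Objective, constraints and operators\<close>

definition objective :: "real^'n^'n \<Rightarrow> real^'n \<Rightarrow> real^'n \<Rightarrow> real" where
  "objective G c z = (1/2) * (z \<bullet> (G *v z)) + c \<bullet> z"

definition gradient :: "real^'n^'n \<Rightarrow> real^'n \<Rightarrow> real^'n \<Rightarrow> real^'n" where
  "gradient G c z = G *v z + c"

definition constr :: "real^'n^'m \<Rightarrow> real^'m \<Rightarrow> 'm \<Rightarrow> real^'n \<Rightarrow> real" where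
  "constr D h i z = D $ i \<bullet> z + h $ i"

definition neg_curv :: "real^'n^'n \<Rightarrow> real^'n^'m \<Rightarrow> 'm set" where
  "neg_curv G D = {i. D $ i \<bullet> (matrix_inv G *v D $ i) < 0}"

definition Nmat :: "real^'n^'m \<Rightarrow> 'm set \<Rightarrow> real^'m^'n" where
  "Nmat D \<alpha> = transpose (sel_rows \<alpha> D)"

definition Nstar :: "real^'n^'n \<Rightarrow> real^'n^'m \<Rightarrow> 'm set \<Rightarrow> real^'n^'m" where
  "Nstar G D \<alpha> = (let N = Nmat D \<alpha> in
     inv_on \<alpha> (transpose N ** matrix_inv G ** N) ** transpose N ** matrix_inv G)"

definition Hmat :: "real^'n^'n \<Rightarrow> real^'n^'m \<Rightarrow> 'm set \<Rightarrow> real^'n^'n" where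
  "Hmat G D \<alpha> = (let N = Nmat D \<alpha> in
     matrix_inv G - matrix_inv G ** N ** inv_on \<alpha> (transpose N ** matrix_inv G ** N)
       ** transpose N ** matrix_inv G)"

definition Gamma_mat ::
  "real^('x::finite + 'y::finite)^('x::finite + 'y::finite) \<Rightarrow> real^('x::finite + 'y::finite)^'m \<Rightarrow> 'm set \<Rightarrow> real^'x^'x" where
  "Gamma_mat G D \<alpha> =
     (let A = sel_rows \<alpha> (left_cols D); B = sel_rows \<alpha> (right_cols D) in
      blk11 G - hblock (blk12 G) (transpose A)
        ** inv_on (UNIV <+> \<alpha>) (vblock (hblock (blk22 G) (transpose B)) (hblock B 0))
        ** vblock (transpose (blk12 G)) A)"

section \<open>Local minimax points and S-pairs\<close>

definition feasible_y ::
  "real^('x::finite + 'y::finite)^'m \<Rightarrow> real^'m \<Rightarrow> 'm set \<Rightarrow> real^'x \<Rightarrow> (real^'y) set" where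
  "feasible_y D h J x = {y. \<forall>i\<in>J. constr D h i (join x y) \<le> 0}"

text \<open>Part of the second inequality is that the maximum on its right-hand side exists.\<close>

definition local_minimax ::
  "real^('x::finite + 'y::finite)^('x::finite + 'y::finite) \<Rightarrow> real^('x::finite + 'y::finite) \<Rightarrow> real^('x::finite + 'y::finite)^'m \<Rightarrow> real^'m \<Rightarrow> 'm set
    \<Rightarrow> real^'x \<Rightarrow> real^'y \<Rightarrow> bool" where
  "local_minimax G c D h J xs ys \<longleftrightarrow>
     ys \<in> feasible_y D h J xs \<and>
     (\<exists>\<delta>0 > 0. \<exists>\<eta> :: real \<Rightarrow> real.
        (\<forall>\<delta>\<in>{0<..\<delta>0}. 0 \<le> \<eta> \<delta>) \<and> (\<eta> \<longlongrightarrow> 0) (at_right 0) \<and>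
        (\<forall>\<delta>\<in>{0<..\<delta>0}. \<forall>x\<in>cball xs \<delta>. \<forall>y\<in>feasible_y D h J xs \<inter> cball ys \<delta>.
           objective G c (join xs y) \<le> objective G c (join xs ys) \<and>
           (\<exists>\<mu>. (\<exists>\<omega>\<in>feasible_y D h J x \<inter> cball ys (\<eta> \<delta>). \<mu> = objective G c (join x \<omega>)) \<and>
                (\<forall>\<omega>\<in>feasible_y D h J x \<inter> cball ys (\<eta> \<delta>). objective G c (join x \<omega>) \<le> \<mu>) \<and>
                objective G c (join xs ys) \<le> \<mu>)))"

definition S_pair ::
  "real^('x::finite + 'y::finite)^('x::finite + 'y::finite) \<Rightarrow> real^('x::finite + 'y::finite) \<Rightarrow> real^('x::finite + 'y::finite)^'m \<Rightarrow> real^'m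
    \<Rightarrow> real^('x::finite + 'y::finite) \<Rightarrow> 'm set \<Rightarrow> bool" where
  "S_pair G c D h z \<alpha> \<longleftrightarrow>
     local_minimax G c D h \<alpha> (xpart z) (ypart z) \<and>
     (\<forall>i\<in>\<alpha>. constr D h i z = 0) \<and>
     (\<exists>l :: 'm \<Rightarrow> real. (\<forall>i\<in>\<alpha>. l i \<le> 0) \<and> gradient G c z + (\<Sum>i\<in>\<alpha>. l i *\<^sub>R D $ i) = 0) \<and>
     independent_rows \<alpha> (right_cols D) \<and> pos_definite (Gamma_mat G D \<alpha>) \<and>
     independent_rows \<alpha> D"

section \<open>The step procedure\<close>

text \<open>
  A state is \<open>(z, \<alpha>, u)\<close>, where \<open>u\<close> is supported on \<open>\<alpha> \<union> {p}\<close> and holds the extended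
  multiplier vector. In this representation \<open>(u, 0)\<close> is \<open>u\<close> itself (its entry at \<open>p \<notin> \<alpha>\<close> is
  zero), \<open>(r, 1)\<close> is \<open>r + axis p 1\<close>, and deleting an entry means setting it to zero.
\<close>

type_synonym ('n, 'm) state = "(real^'n) \<times> 'm set \<times> (real^'m)"

definition start_state ::
  "real^'n^'n \<Rightarrow> real^'n \<Rightarrow> real^'n^'m \<Rightarrow> real^'n \<Rightarrow> 'm set \<Rightarrow> ('n, 'm) state" where
  "start_state G c D z \<alpha> = (z, \<alpha>, - (Nstar G D \<alpha> *v gradient G c z))"

definition dir_z :: "real^'n^'n \<Rightarrow> real^'n^'m \<Rightarrow> 'm \<Rightarrow> 'm set \<Rightarrow> real^'n" where
  "dir_z G D p \<alpha> = Hmat G D \<alpha> *v D $ p"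

definition dir_r :: "real^'n^'n \<Rightarrow> real^'n^'m \<Rightarrow> 'm \<Rightarrow> 'm set \<Rightarrow> real^'m" where
  "dir_r G D p \<alpha> = - (Nstar G D \<alpha> *v D $ p)"

definition step_t1 :: "real^'n^'n \<Rightarrow> real^'n^'m \<Rightarrow> 'm \<Rightarrow> ('n, 'm) state \<Rightarrow> ereal" where
  "step_t1 G D p = (\<lambda>(z, \<alpha>, u). let r = dir_r G D p \<alpha> in
     Min (insert \<infinity> ((\<lambda>j. ereal (u $ j / r $ j)) ` {j\<in>\<alpha>. r $ j < 0})))"

definition step_t2 ::
  "real^'n^'n \<Rightarrow> real^'n^'m \<Rightarrow> real^'m \<Rightarrow> 'm \<Rightarrow> ('n, 'm) state \<Rightarrow> ereal" where
  "step_t2 G D h p = (\<lambda>(z, \<alpha>, u). let d = dir_z G D p \<alpha> in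
     if d \<bullet> D $ p \<ge> 0 then \<infinity> else ereal (- constr D h p z / (d \<bullet> D $ p)))"

text \<open>
  One pass of the loop with step length \<open>t = min t\<^sub>1 t\<^sub>2 < \<infinity>\<close>. The index \<open>k\<close> attaining \<open>t\<^sub>1\<close>
  need not be unique, so a partial step is a relation. A state with \<open>t = \<infinity>\<close>, where the
  procedure stops without a result, admits neither kind of step.
\<close>

definition partial_step ::
  "real^'n^'n \<Rightarrow> real^'n^'m \<Rightarrow> real^'m \<Rightarrow> 'm \<Rightarrow> ('n, 'm) state \<Rightarrow> ('n, 'm) state \<Rightarrow> bool" where
  "partial_step G D h p = (\<lambda>(z, \<alpha>, u) (z', \<alpha>', u').
     \<exists>t k. ereal t = min (step_t1 G D p (z, \<alpha>, u)) (step_t2 G D h p (z, \<alpha>, u)) \<and>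
       ereal t \<noteq> step_t2 G D h p (z, \<alpha>, u) \<and>
       k \<in> \<alpha> \<and> dir_r G D p \<alpha> $ k < 0 \<and>
       ereal (u $ k / dir_r G D p \<alpha> $ k) = step_t1 G D p (z, \<alpha>, u) \<and>
       z' = z + t *\<^sub>R dir_z G D p \<alpha> \<and>
       \<alpha>' = \<alpha> - {k} \<and>
       u' = (\<chi> j. if j = k then 0 else (u - t *\<^sub>R (dir_r G D p \<alpha> + axis p 1)) $ j))"

definition full_step ::
  "real^'n^'n \<Rightarrow> real^'n^'m \<Rightarrow> real^'m \<Rightarrow> 'm \<Rightarrow> ('n, 'm) state \<Rightarrow> (real^'n) \<times> 'm set \<Rightarrow> bool" where
  "full_step G D h p = (\<lambda>(z, \<alpha>, u) (z', \<alpha>').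
     \<exists>t. ereal t = min (step_t1 G D p (z, \<alpha>, u)) (step_t2 G D h p (z, \<alpha>, u)) \<and>
       ereal t = step_t2 G D h p (z, \<alpha>, u) \<and>
       z' = z + t *\<^sub>R dir_z G D p \<alpha> \<and>
       \<alpha>' = insert p \<alpha>)"

end

(*
  Writing D_b for the active rows and N_b for their transpose, the two S-pair conditions
  "B_b has independent rows" and "Gamma_b is positive definite" together say that
  N_b^T G^-1 N_b is negative definite. This follows from two facts about the saddle form G:
  z^T G z < 0 for z <> 0 with x-part 0, and z^T G z > 0 for z <> 0 with (G z)_y = 0. Unlike
  Gamma_b, the matrix N_b^T G^-1 N_b restricts to subsets of b, and it stays negative definite
  when p is added because n_p^T H n_p < 0. So every working set the procedure meets, together
  with p, satisfies the S-pair definiteness conditions, and d^T n_p = d^T G d < 0 makes the full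
  step length t2 finite. Along a step the multipliers stay nonpositive, stationarity is
  preserved, and f changes by t (d^T n_p) (t/2 - u_p), which is
  negative for t > 0. Finally, first-order stationarity and
  Gamma_b > 0 imply local minimaxity: the maximiser's response to x is the affine map into the
  face D_b z + h_b = 0 along which the second-order term of f is v^T Gamma_b v / 2.
*)
theory Submission
  imports Defs
begin

section \<open>Block vectors and matrix-vector products\<close>

lemma sum_Plus_UNIV:
  fixes f :: "'a::finite + 'b::finite \<Rightarrow> 'c::comm_monoid_add"
  shows "sum f UNIV = (\<Sum>a\<in>UNIV. f (Inl a)) + (\<Sum>b\<in>UNIV. f (Inr b))"
  by (simp add: UNIV_Plus_UNIV[symmetric] sum.Plus del: UNIV_Plus_UNIV)

lemma inner_blocks: "z \<bullet> w = xpart z \<bullet> xpart w + ypart z \<bullet> ypart w"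
  by (simp add: inner_vec_def sum_Plus_UNIV xpart_def ypart_def)

lemma xpart_join [simp]: "xpart (join x y) = x"
  and ypart_join [simp]: "ypart (join x y) = y"
  and join_parts [simp]: "join (xpart z) (ypart z) = z"
  by (auto simp: xpart_def ypart_def join_def vec_eq_iff split: sum.split)

lemma parts_eqI: "xpart z = xpart w \<Longrightarrow> ypart z = ypart w \<Longrightarrow> z = w"
  by (metis join_parts)

lemma parts_linear [simp]:
  "xpart (z + w) = xpart z + xpart w" "ypart (z + w) = ypart z + ypart w"
  "xpart (z - w) = xpart z - xpart w" "ypart (z - w) = ypart z - ypart w"
  "xpart (- z) = - xpart z" "ypart (- z) = - ypart z"
  "xpart 0 = 0" "ypart 0 = 0"
  by (auto simp: xpart_def ypart_def vec_eq_iff)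

lemma vblock_mult: "vblock M N *v v = join (M *v v) (N *v v)"
  by (auto simp: vblock_def join_def matrix_vector_mult_def vec_eq_iff split: sum.split)

lemma hblock_mult: "hblock M N *v q = M *v xpart q + N *v ypart q"
  by (simp add: hblock_def join_def matrix_vector_mult_def vec_eq_iff sum_Plus_UNIV
      xpart_def ypart_def)

lemma xpart_mult: "xpart (G *v z) = blk11 G *v xpart z + blk12 G *v ypart z"
  by (simp add: matrix_vector_mult_def vec_eq_iff sum_Plus_UNIV
      xpart_def ypart_def blk11_def blk12_def)

lemma ypart_mult:
  assumes "transpose G = G"
  shows "ypart (G *v z) = transpose (blk12 G) *v xpart z + blk22 G *v ypart z"
proof -
  have "G $ i $ j = G $ j $ i" for i j
    using arg_cong[OF assms, of "\<lambda>M. M $ i $ j"] by (simp add: transpose_def)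
  then show ?thesis
    by (simp add: matrix_vector_mult_def vec_eq_iff sum_Plus_UNIV
      xpart_def ypart_def blk12_def blk22_def transpose_def)
qed

lemma inner_transpose_mult:
  fixes D :: "real^'n^'m"
  shows "w \<bullet> (transpose D *v u) = (D *v w) \<bullet> u"
  by (metis dot_lmul_matrix inner_commute transpose_matrix_vector)

lemma symmetric_inner:
  fixes G :: "real^'n^'n"
  assumes "transpose G = G"
  shows "v \<bullet> (G *v w) = (G *v v) \<bullet> w"
  by (metis assms inner_transpose_mult)

lemma mult_nth:
  fixes D :: "real^'n^'m"
  shows "(D *v w) $ i = D $ i \<bullet> w"
  by (simp add: matrix_vector_mult_def inner_vec_def)

lemma transpose_mult_sum:
  fixes D :: "real^'n^'m"
  shows "transpose D *v u = (\<Sum>i\<in>UNIV. u $ i *\<^sub>R D $ i)"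
  by (simp add: matrix_vector_mult_def vec_eq_iff transpose_def mult.commute)

section \<open>Index subsets: zero extension, inverses and independent rows\<close>

text \<open>Vectors indexed by \<open>b\<close> are kept as zero extensions to the full index type,
  the convention that \<open>sel_rows\<close> and \<open>inv_on\<close> follow as well.\<close>

definition supported_on :: "'m set \<Rightarrow> real^'m \<Rightarrow> bool" where
  "supported_on b u \<longleftrightarrow> (\<forall>i. i \<notin> b \<longrightarrow> u $ i = 0)"

text \<open>The zeros of \<open>u\<close> already mask the rows outside \<open>b\<close>. Row
  selection can thus be dropped, and N_b u is handled as \<open>transpose D *v u\<close> from here
  on.\<close>

lemma transpose_sel_rows_mult:
  fixes D :: "real^'n^'m"
  assumes "supported_on b u"
  shows "transpose (sel_rows b D) *v u = transpose D *v u"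
  using assms unfolding transpose_mult_sum supported_on_def sel_rows_def
  by (intro sum.cong) auto

lemma sel_rows_mult_nth: "(sel_rows b D *v w) $ i = (if i \<in> b then D $ i \<bullet> w else 0)"
  by (simp add: mult_nth sel_rows_def)

text \<open>A direction tangent to the constraints in \<open>b\<close> is orthogonal to every
  combination of their normals. This is what makes the mixed terms vanish whenever a quadratic form
  is split below.\<close>

lemma inner_transpose_eq_0:
  fixes D :: "real^'n^'m"
  assumes "supported_on b u" "\<forall>i\<in>b. D $ i \<bullet> w = 0"
  shows "w \<bullet> (transpose D *v u) = 0"
proof -
  have "(D *v w) $ i \<bullet> u $ i = 0" for i
    using assms by (cases "i \<in> b") (auto simp: mult_nth supported_on_def)
  then show ?thesis
    unfolding inner_transpose_mult by (auto simp: inner_vec_def intro!: sum.neutral)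
qed

lemma id_on_mult: "id_on I *v v = (\<chi> i. if i \<in> I then v $ i else 0)"
proof -
  have "(\<Sum>j\<in>UNIV. (if i = j \<and> i \<in> I then 1 else 0) * v $ j) = (if i \<in> I then v $ i else 0)" for i
  proof (cases "i \<in> I")
    case True
    then have "(\<Sum>j\<in>UNIV. (if i = j \<and> i \<in> I then 1 else 0) * v $ j) = (\<Sum>j\<in>UNIV. if i = j then v $ j else 0)"
      by (intro sum.cong) auto
    with True show ?thesis by simp
  qed simp
  then show ?thesis
    by (simp add: id_on_def matrix_vector_mult_def vec_eq_iff)
qed

lemma id_on_mult_supported: "supported_on I v \<Longrightarrow> id_on I *v v = v"
  by (auto simp: id_on_mult supported_on_def vec_eq_iff)

text \<open>Padding \<open>M\<close> with the identity on the complement of \<open>I\<close> gives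
  an injective, hence invertible, square matrix. Cutting its inverse back to \<open>I\<close> yields
  a witness for the choice in \<open>inv_on\<close>.\<close>

lemma inv_on_works:
  fixes M :: "real^'a^'a"
  assumes M0: "\<And>i j. i \<notin> I \<or> j \<notin> I \<Longrightarrow> M $ i $ j = 0"
    and inj: "\<And>v. supported_on I v \<Longrightarrow> M *v v = 0 \<Longrightarrow> v = 0"
  shows "supported_on I (inv_on I M *v v)"
    and "M *v (inv_on I M *v v) = id_on I *v v"
    and "inv_on I M *v (M *v v) = id_on I *v v"
proof -
  define M' where "M' = M + id_on (- I)"
  have M'v: "M' *v v = M *v v + (\<chi> i. if i \<in> I then 0 else v $ i)" for v
    by (auto simp: M'_def matrix_vector_mult_add_rdistrib id_on_mult vec_eq_iff)
  have Mi: "(M *v v) $ i = 0" if "i \<notin> I" for v i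
    using that M0 by (simp add: matrix_vector_mult_def)
  have Mid: "M *v (id_on I *v v) = M *v v" for v
    unfolding id_on_mult using M0 by (auto simp: matrix_vector_mult_def vec_eq_iff intro!: sum.cong)
  have "v = 0" if "M' *v v = 0" for v
  proof -
    have s: "supported_on I v"
      unfolding supported_on_def
    proof (intro allI impI)
      fix i assume "i \<notin> I"
      with arg_cong[OF that, of "\<lambda>w. w $ i"] Mi[of i v] show "v $ i = 0"
        by (simp add: M'v)
    qed
    then have "(\<chi> i. if i \<in> I then 0 else v $ i) = 0"
      by (auto simp: supported_on_def vec_eq_iff)
    with that have "M *v v = 0" by (simp add: M'v)
    with s show ?thesis using inj by blast
  qed
  then obtain Y where Y: "Y ** M' = mat 1"
    using matrix_left_invertible_ker by blast
  then have Y': "M' ** Y = mat 1" by (simp add: matrix_left_right_inverse)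
  have YM: "Y *v (M' *v v) = v" "M' *v (Y *v v) = v" for v
    using Y Y' by (metis matrix_vector_mul_assoc matrix_vector_mul_lid)+
  have idM': "id_on I *v (M' *v v) = M *v v" "M' *v (id_on I *v v) = M *v v" for v
    using Mi[of _ v] Mid[of v] by (auto simp: M'v id_on_mult vec_eq_iff)
  define X where "X = id_on I ** Y ** id_on I"
  have X: "X *v v = id_on I *v (Y *v (id_on I *v v))" for v
    by (simp add: X_def matrix_vector_mul_assoc matrix_mul_assoc)
  have idid: "id_on I *v (id_on I *v v) = id_on I *v v" for v :: "real^'a"
    by (simp add: id_on_mult vec_eq_iff)
  have idMv: "id_on I *v (M *v v) = M *v v" for v
    using Mi by (auto simp: id_on_mult vec_eq_iff)
  have MX: "M *v (X *v v) = id_on I *v v" for v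
  proof -
    have "M *v (X *v v) = M *v (Y *v (id_on I *v v))" by (simp add: X Mid)
    also have "\<dots> = id_on I *v (id_on I *v v)" by (metis idM'(1) YM(2))
    finally show ?thesis by (simp add: idid)
  qed
  have XM: "X *v (M *v v) = id_on I *v v" for v
    by (metis X idMv idM'(2) YM(1) idid)
  have X0: "X $ i $ j = 0" if "i \<notin> I \<or> j \<notin> I" for i j
  proof -
    have "X $ i $ j = (X *v axis j 1) $ i"
      by (simp add: matrix_vector_mult_basis column_def)
    also have "\<dots> = 0"
    proof (cases "i \<in> I")
      case True
      with that have "id_on I *v axis j 1 = 0"
        by (auto simp: id_on_mult axis_def vec_eq_iff)
      then show ?thesis by (simp add: X)
    qed (simp add: X id_on_mult)
    finally show ?thesis .
  qed
  have "(\<forall>i j. i \<notin> I \<or> j \<notin> I \<longrightarrow> X $ i $ j = 0) \<and> M ** X = id_on I \<and> X ** M = id_on I"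
    using X0 MX XM by (auto simp: matrix_eq matrix_vector_mul_assoc[symmetric])
  then have *: "(\<forall>i j. i \<notin> I \<or> j \<notin> I \<longrightarrow> inv_on I M $ i $ j = 0) \<and>
      M ** inv_on I M = id_on I \<and> inv_on I M ** M = id_on I"
    unfolding inv_on_def by (rule someI)
  then show "supported_on I (inv_on I M *v v)"
    by (simp add: supported_on_def matrix_vector_mult_def)
  from * show "M *v (inv_on I M *v v) = id_on I *v v" "inv_on I M *v (M *v v) = id_on I *v v"
    by (simp_all add: matrix_vector_mul_assoc)
qed

text \<open>As a simp rule it would turn \<open>transpose D *v u\<close> into a vector-matrix
  product and so destroy the form in which normal combinations are written here.\<close>

declare transpose_matrix_vector [simp del]

lemma matrix_mult_uminus:
  fixes M :: "real^'n^'m"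
  shows "M *v (- v) = - (M *v v)"
  by (simp add: matrix_vector_mult_def vec_eq_iff sum_negf)

text \<open>Kernel form of independence. A repeated row appears as the kernel vector
  \<open>axis i 1 - axis j 1\<close>, which accounts for the injectivity clause.\<close>

lemma independent_rows_iff:
  fixes M :: "real^'n^'m"
  shows "independent_rows b M \<longleftrightarrow> (\<forall>u. supported_on b u \<and> transpose M *v u = 0 \<longrightarrow> u = 0)"
proof
  assume ind: "independent_rows b M"
  show "\<forall>u. supported_on b u \<and> transpose M *v u = 0 \<longrightarrow> u = 0"
  proof (intro allI impI)
    fix u assume u: "supported_on b u \<and> transpose M *v u = 0"
    have inj: "inj_on (\<lambda>i. M $ i) b" and li: "independent ((\<lambda>i. M $ i) ` b)"
      using ind by (auto simp: independent_rows_def)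
    define g where "g = (\<lambda>v. u $ the_inv_into b (\<lambda>i. M $ i) v)"
    have g: "g (M $ i) = u $ i" if "i \<in> b" for i
      using that inj by (simp add: g_def the_inv_into_f_f)
    have "0 = (\<Sum>i\<in>UNIV. u $ i *\<^sub>R M $ i)"
      using u by (simp add: transpose_mult_sum)
    also have "\<dots> = (\<Sum>i\<in>b. u $ i *\<^sub>R M $ i)"
      using u by (intro sum.mono_neutral_right) (auto simp: supported_on_def)
    also have "\<dots> = (\<Sum>v\<in>(\<lambda>i. M $ i) ` b. g v *\<^sub>R v)"
      using inj g by (simp add: sum.reindex)
    finally have "(\<Sum>v\<in>(\<lambda>i. M $ i) ` b. g v *\<^sub>R v) = 0" by simp
    then have "\<forall>v\<in>(\<lambda>i. M $ i) ` b. g v = 0"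
      using li by (auto simp: dependent_finite)
    with u g show "u = 0"
      by (auto simp: vec_eq_iff supported_on_def)
  qed
next
  assume *: "\<forall>u. supported_on b u \<and> transpose M *v u = 0 \<longrightarrow> u = 0"
  have inj: "inj_on (\<lambda>i. M $ i) b"
  proof (rule inj_onI, rule ccontr)
    fix i j assume ij: "i \<in> b" "j \<in> b" "M $ i = M $ j" "i \<noteq> j"
    define u :: "real^'m" where "u = axis i 1 - axis j 1"
    have "supported_on b u"
      using ij by (auto simp: u_def supported_on_def axis_def)
    moreover have "transpose M *v u = 0"
      using ij by (simp add: u_def matrix_vector_mult_diff_distrib matrix_vector_mult_basis
        column_transpose row_def)
    ultimately have "u $ i = 0" using * by force
    with ij show False
      by (simp add: u_def axis_def)
  qed
  moreover have "independent ((\<lambda>i. M $ i) ` b)"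
  proof
    assume "dependent ((\<lambda>i. M $ i) ` b)"
    then obtain g i where i: "i \<in> b" "g (M $ i) \<noteq> 0"
      and g: "(\<Sum>v\<in>(\<lambda>i. M $ i) ` b. g v *\<^sub>R v) = 0"
      by (auto simp: dependent_finite)
    define u :: "real^'m" where "u = (\<chi> i. if i \<in> b then g (M $ i) else 0)"
    have "(\<Sum>i\<in>UNIV. u $ i *\<^sub>R M $ i) = (\<Sum>i\<in>b. u $ i *\<^sub>R M $ i)"
      by (intro sum.mono_neutral_right) (auto simp: u_def)
    also have "\<dots> = 0"
      using g inj by (simp add: sum.reindex u_def)
    finally have "u = 0"
      using * by (simp add: transpose_mult_sum supported_on_def u_def)
    then have "u $ i = 0" by simp
    with i show False by (simp add: u_def)
  qed
  ultimately show "independent_rows b M"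
    by (simp add: independent_rows_def)
qed

section \<open>Column blocks of the constraint matrix; ordinary matrix inverses\<close>

lemma left_right_cols_mult:
  "D $ i \<bullet> w = left_cols D $ i \<bullet> xpart w + right_cols D $ i \<bullet> ypart w"
  by (simp add: left_cols_def right_cols_def inner_blocks)

lemma xpart_transpose_mult: "xpart (transpose D *v u) = transpose (left_cols D) *v u"
  and ypart_transpose_mult: "ypart (transpose D *v u) = transpose (right_cols D) *v u"
  by (simp_all add: xpart_def ypart_def left_cols_def right_cols_def matrix_vector_mult_def
      vec_eq_iff transpose_def)

lemma norm_xpart_le: "norm (xpart z) \<le> norm z"
  by (simp add: norm_eq_sqrt_inner inner_blocks)

lemma matrix_inv_mult:
  assumes "invertible A"
  shows "A ** matrix_inv A = mat 1" "matrix_inv A ** A = mat 1"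
  using someI_ex[of "\<lambda>X. A ** X = mat 1 \<and> X ** A = mat 1"] assms
  unfolding invertible_def matrix_inv_def by blast+

lemma matrix_inv_apply:
  assumes "invertible A"
  shows "A *v (matrix_inv A *v v) = v" "matrix_inv A *v (A *v v) = v"
  using matrix_inv_mult[OF assms]
  by (metis matrix_vector_mul_assoc matrix_vector_mul_lid)+

lemma invertibleI_ker:
  fixes A :: "real^'n^'n"
  assumes "\<And>v. A *v v = 0 \<Longrightarrow> v = 0"
  shows "invertible A"
  using assms matrix_left_invertible_ker[of A] by (auto simp: invertible_left_inverse)

section \<open>The saddle form G: signs on two complementary subspaces\<close>

locale saddle_form =
  fixes G :: "real^('x::finite + 'y::finite)^('x + 'y)"
  assumes sym: "transpose G = G"
    and neg22: "neg_definite (blk22 G)"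
    and schur: "pos_definite (blk11 G - blk12 G ** matrix_inv (blk22 G) ** transpose (blk12 G))"
begin

lemma blk22_neg: "y \<noteq> 0 \<Longrightarrow> y \<bullet> (blk22 G *v y) < 0"
proof -
  have "(- blk22 G) *v y = - (blk22 G *v y)"
    by (simp add: matrix_vector_mult_def vec_eq_iff sum_negf)
  then show "y \<noteq> 0 \<Longrightarrow> y \<bullet> (blk22 G *v y) < 0"
    using neg22 unfolding neg_definite_def pos_definite_def by force
qed

lemma invertible_blk22: "invertible (blk22 G)"
  using blk22_neg by (intro invertibleI_ker) force

lemma form_neg: "xpart z = 0 \<Longrightarrow> z \<noteq> 0 \<Longrightarrow> z \<bullet> (G *v z) < 0"
  using blk22_neg[of "ypart z"] parts_eqI[of z 0]
  by (auto simp: inner_blocks[of z "G *v z"] ypart_mult[OF sym])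

lemma form_nonpos: "xpart z = 0 \<Longrightarrow> z \<bullet> (G *v z) \<le> 0"
  using form_neg[of z] by (cases "z = 0") auto

text \<open>The condition (G z)_y = 0 determines y = -G22^-1 G12^T x, and substituting it turns the
  form into the Schur complement at x. If x were zero, y would be zero too.\<close>

lemma form_pos:
  assumes "ypart (G *v z) = 0" "z \<noteq> 0"
  shows "0 < z \<bullet> (G *v z)"
proof -
  let ?x = "xpart z" and ?y = "ypart z"
  have e: "blk22 G *v ?y = - (transpose (blk12 G) *v ?x)"
    using assms(1) by (simp add: ypart_mult[OF sym] eq_neg_iff_add_eq_0 add.commute)
  have y: "matrix_inv (blk22 G) *v (transpose (blk12 G) *v ?x) = - ?y"
    using arg_cong[OF e, of "\<lambda>v. matrix_inv (blk22 G) *v v"] matrix_inv_apply[OF invertible_blk22]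
    by (simp add: matrix_mult_uminus)
  have x: "?x \<noteq> 0"
  proof
    assume "?x = 0"
    with y have "?y = 0" by simp
    with \<open>?x = 0\<close> assms(2) show False using parts_eqI[of z 0] by simp
  qed
  have "z \<bullet> (G *v z) = ?x \<bullet> (blk11 G *v ?x + blk12 G *v ?y)"
    by (simp add: inner_blocks[of z "G *v z"] assms(1) xpart_mult)
  also have "\<dots> = ?x \<bullet> ((blk11 G - blk12 G ** matrix_inv (blk22 G) ** transpose (blk12 G)) *v ?x)"
    by (simp add: matrix_vector_mult_diff_rdistrib matrix_vector_mul_assoc[symmetric] y
        matrix_mult_uminus)
  also have "\<dots> > 0" using schur x by (simp add: pos_definite_def)
  finally show ?thesis .
qed

lemma form_nonneg: "ypart (G *v z) = 0 \<Longrightarrow> 0 \<le> z \<bullet> (G *v z)"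
  using form_pos[of z] by (cases "z = 0") auto

text \<open>A nonzero kernel vector would satisfy the hypothesis of \<open>form_pos\<close> while
  its form is zero.\<close>

lemma invertible_form: "invertible G"
  using form_pos by (intro invertibleI_ker) force

section \<open>Gamma as the reduced form on the tangent space of the active constraints\<close>

text \<open>Solving the saddle system inside \<open>Gamma_mat\<close> extends \<open>v\<close> to a
  tangent vector \<open>W v\<close> with multipliers \<open>U v\<close> such that the y-part of G W
  v + D^T U v vanishes; its x-part is then Gamma v. All later facts about Gamma come from this
  equation. The bound by \<open>L\<close> controls the size of the y-response.\<close>

lemma Gamma_lift:
  fixes D :: "real^('x + 'y)^('m::finite)"
  assumes "independent_rows b (right_cols D)"
  obtains W U L where "\<And>v. xpart (W v) = v" "\<And>v i. i \<in> b \<Longrightarrow> D $ i \<bullet> W v = 0"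
    "\<And>v. supported_on b (U v)"
    "\<And>v. G *v W v + transpose D *v U v = join (Gamma_mat G D b *v v) 0"
    "\<And>v. norm (ypart (W v)) \<le> L * norm v"
proof -
  let ?A = "sel_rows b (left_cols D)" and ?B = "sel_rows b (right_cols D)"
  let ?I = "UNIV <+> b :: ('y + 'm) set"
  define K where "K = vblock (hblock (blk22 G) (transpose ?B)) (hblock ?B 0)"
  define R where "R = vblock (transpose (blk12 G)) ?A"
  have K0: "K $ i $ j = 0" if "i \<notin> ?I \<or> j \<notin> ?I" for i j
    using that
    by (cases i; cases j)
      (auto simp: K_def vblock_def hblock_def join_def sel_rows_def transpose_def)
  have Kv: "K *v q = join (blk22 G *v xpart q + transpose ?B *v ypart q) (?B *v xpart q)" for q
    by (simp add: K_def vblock_mult hblock_mult)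
  have supp: "supported_on b (ypart q)" if "supported_on ?I q" for q
    using that by (auto simp: supported_on_def ypart_def)
  have Kinj: "q = 0" if s: "supported_on ?I q" and q0: "K *v q = 0" for q
  proof -
    let ?y = "xpart q" and ?u = "ypart q"
    have 1: "blk22 G *v ?y + transpose ?B *v ?u = 0" and 2: "?B *v ?y = 0"
      using arg_cong[OF q0, of xpart] arg_cong[OF q0, of ypart] by (auto simp: Kv)
    \<comment> \<open>Pairing the first block row with y removes the multiplier term, since the
      second block row says B y = 0.\<close>
    have "?y \<bullet> (blk22 G *v ?y) = 0"
      using arg_cong[OF 1, of "\<lambda>v. ?y \<bullet> v"] 2
      by (simp add: inner_add_right inner_transpose_mult)
    then have y: "?y = 0" using blk22_neg by force
    with 1 have "transpose (right_cols D) *v ?u = 0"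
      by (simp add: transpose_sel_rows_mult[OF supp[OF s]])
    with assms supp[OF s] have "?u = 0" by (auto simp: independent_rows_iff)
    with y show ?thesis using parts_eqI[of q 0] by simp
  qed
  have inv: "supported_on ?I (inv_on ?I K *v v)" "K *v (inv_on ?I K *v v) = id_on ?I *v v" for v
    by (rule inv_on_works; fact K0 Kinj)+
  \<comment> \<open>The solution of K q = -R v: its first block is the y-response to v, its second
    block the multiplier vector.\<close>
  define q where "q v = - (inv_on ?I K *v (R *v v))" for v
  define W where "W v = join v (xpart (q v))" for v
  define U where "U v = ypart (q v)" for v
  have sq: "supported_on ?I (q v)" for v
    using inv(1)[of "R *v v"] unfolding q_def supported_on_def by simp
  have Kq: "K *v q v = - (R *v v)" for v
  proof -
    have "supported_on ?I (R *v v)"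
      by (auto simp: supported_on_def R_def vblock_mult join_def sel_rows_mult_nth split: sum.split)
    then show ?thesis
      using inv(2)[of "R *v v"]
      unfolding q_def matrix_mult_uminus by (metis id_on_mult_supported)
  qed
  have sU: "supported_on b (U v)" for v
    using supp[OF sq] by (simp add: U_def)
  have 1: "blk22 G *v xpart (q v) + transpose (right_cols D) *v U v = - (transpose (blk12 G) *v v)"
    and 2: "?B *v xpart (q v) = - (?A *v v)" for v
    using arg_cong[OF Kq[of v], of xpart] arg_cong[OF Kq[of v], of ypart]
    by (auto simp: Kv R_def vblock_mult U_def transpose_sel_rows_mult[OF supp[OF sq]])
  have G: "Gamma_mat G D b *v v = xpart (G *v W v) + transpose (left_cols D) *v U v" for v
  proof -
    have "Gamma_mat G D b = blk11 G - hblock (blk12 G) (transpose ?A) ** inv_on ?I K ** R"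
      by (simp add: Gamma_mat_def Let_def K_def R_def)
    then have "Gamma_mat G D b *v v = blk11 G *v v - hblock (blk12 G) (transpose ?A) *v (- q v)"
      by (simp add: matrix_vector_mult_diff_rdistrib matrix_vector_mul_assoc[symmetric] q_def)
    then show ?thesis
      by (simp add: hblock_mult matrix_mult_uminus xpart_mult W_def
        transpose_sel_rows_mult[OF supp[OF sq]] U_def)
  qed
  show thesis
  proof
    show "xpart (W v) = v" for v by (simp add: W_def)
    show "supported_on b (U v)" for v by (rule sU)
    show "D $ i \<bullet> W v = 0" if "i \<in> b" for v i
      using arg_cong[OF 2[of v], of "\<lambda>w. w $ i"] that
      by (simp add: left_right_cols_mult W_def sel_rows_mult_nth)
    show "G *v W v + transpose D *v U v = join (Gamma_mat G D b *v v) 0" for v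
    proof (rule parts_eqI)
      show "xpart (G *v W v + transpose D *v U v) = xpart (join (Gamma_mat G D b *v v) 0)"
        by (simp add: G xpart_transpose_mult)
      show "ypart (G *v W v + transpose D *v U v) = ypart (join (Gamma_mat G D b *v v) 0)"
        using 1[of v] by (simp add: ypart_transpose_mult ypart_mult[OF sym] W_def algebra_simps)
    qed
    have "norm (ypart (W v)) \<le> norm ((inv_on ?I K ** R) *v v)" for v
      using norm_xpart_le[of "q v"] by (simp add: W_def q_def matrix_vector_mul_assoc)
    then show "norm (ypart (W v)) \<le> onorm ((*v) (inv_on ?I K ** R)) * norm v" for v
      using onorm[OF matrix_vector_mul_bounded_linear, of "inv_on ?I K ** R" v]
      by (rule order_trans)
  qed
qed

section \<open>Dual negativity and its equivalence with positive definite Gamma\<close>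

text \<open>
  Negative definiteness of \<open>N\<^sub>b\<^sup>T G\<^sup>-\<^sup>1 N\<^sub>b\<close>, with \<open>w\<close> standing for \<open>G\<^sup>-\<^sup>1 N\<^sub>b u\<close>.
\<close>
definition dual_neg :: "real^('x + 'y)^('m::finite) \<Rightarrow> 'm set \<Rightarrow> bool" where
  "dual_neg D b \<longleftrightarrow>
     (\<forall>w u. supported_on b u \<and> u \<noteq> 0 \<and> G *v w = transpose D *v u \<longrightarrow> w \<bullet> (G *v w) < 0)"

text \<open>A vector supported on a subset is supported on the larger set. This lets one condition
  on the initial set together with \<open>p\<close> serve every later working set.\<close>

lemma dual_neg_mono: "dual_neg D b \<Longrightarrow> a \<subseteq> b \<Longrightarrow> dual_neg D a"
  unfolding dual_neg_def supported_on_def by blast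

text \<open>With v the x-part of w, the tangent vector W v is G-orthogonal to w, because G w is a
  combination of active normals. Hence the form at w equals the form at w - W v, which has x-part 0,
  minus v^T Gamma v.\<close>

lemma dual_neg_if_Gamma_pos:
  assumes ind: "independent_rows b (right_cols D)" and pos: "pos_definite (Gamma_mat G D b)"
  shows "dual_neg D b"
  unfolding dual_neg_def
proof (intro allI impI, elim conjE)
  fix w u assume u: "supported_on b u" "u \<noteq> 0" and w: "G *v w = transpose D *v u"
  obtain W U L where W: "\<And>v. xpart (W v) = v" "\<And>v i. i \<in> b \<Longrightarrow> D $ i \<bullet> W v = 0"
    "\<And>v. supported_on b (U v)"
    "\<And>v. G *v W v + transpose D *v U v = join (Gamma_mat G D b *v v) 0"
    using Gamma_lift[OF ind] by metis
  let ?v = "xpart w"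
  have DW: "W ?v \<bullet> (transpose D *v u') = 0" if "supported_on b u'" for u'
    using inner_transpose_eq_0[OF that] W(2) by blast
  have 1: "W ?v \<bullet> (G *v W ?v) = ?v \<bullet> (Gamma_mat G D b *v ?v)"
    using arg_cong[OF W(4)[of ?v], of "\<lambda>a. W ?v \<bullet> a"] DW[OF W(3)]
    by (simp add: inner_add_right inner_blocks[of _ "join _ _"] W(1))
  have 2: "W ?v \<bullet> (G *v w) = 0" "w \<bullet> (G *v W ?v) = 0"
    using DW[OF u(1)] symmetric_inner[OF sym, of w "W ?v"] by (simp_all add: w inner_commute)
  have 3: "(w - W ?v) \<bullet> (G *v (w - W ?v)) = w \<bullet> (G *v w) + ?v \<bullet> (Gamma_mat G D b *v ?v)"
    by (simp add: matrix_vector_mult_diff_distrib inner_diff 1 2)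
  have 4: "xpart (w - W ?v) = 0" by (simp add: W(1))
  show "w \<bullet> (G *v w) < 0"
  proof (cases "?v = 0")
    case False
    then have "?v \<bullet> (Gamma_mat G D b *v ?v) > 0" using pos by (auto simp: pos_definite_def)
    with form_nonpos[OF 4] 3 show ?thesis by linarith
  next
    \<comment> \<open>Now Gamma contributes nothing, but w itself has x-part 0, and independence of
      the rows of B excludes w = 0.\<close>
    case True
    have "w \<noteq> 0"
    proof
      assume "w = 0"
      with w have "transpose (right_cols D) *v u = 0"
        by (simp add: ypart_transpose_mult[symmetric])
      with ind u show False by (auto simp: independent_rows_iff)
    qed
    with True show ?thesis by (rule form_neg)
  qed
qed

text \<open>If the y-part of D^T u vanishes, then w = G^-1 D^T u has (G w)_y = 0, so its form is
  nonnegative; dual negativity forces u = 0.\<close>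

lemma independent_if_dual_neg:
  assumes "dual_neg D b"
  shows "independent_rows b (right_cols D)" "independent_rows b D"
proof -
  have *: "u = 0" if u: "supported_on b u" "ypart (transpose D *v u) = 0" for u
  proof (rule ccontr)
    assume "u \<noteq> 0"
    define w where "w = matrix_inv G *v (transpose D *v u)"
    have w: "G *v w = transpose D *v u"
      by (simp add: w_def matrix_inv_apply[OF invertible_form])
    then have "w \<bullet> (G *v w) < 0" using assms u \<open>u \<noteq> 0\<close> by (auto simp: dual_neg_def)
    moreover have "w \<bullet> (G *v w) \<ge> 0" using form_nonneg[of w] u w by simp
    ultimately show False by linarith
  qed
  then show "independent_rows b (right_cols D)"
    by (simp add: independent_rows_iff ypart_transpose_mult)
  show "independent_rows b D"
    using * by (auto simp: independent_rows_iff)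
qed

text \<open>Put k = G^-1 D^T U v. Then (G (W v + k))_y = 0, the two summands are G-orthogonal, and
  v^T Gamma v equals the form at W v + k, which is nonnegative, minus the form at k, which is
  negative unless U v = 0.\<close>

lemma Gamma_pos_if_dual_neg:
  assumes neg: "dual_neg D b"
  shows "pos_definite (Gamma_mat G D b)"
proof -
  obtain W U L where W: "\<And>v. xpart (W v) = v" "\<And>v i. i \<in> b \<Longrightarrow> D $ i \<bullet> W v = 0"
    "\<And>v. supported_on b (U v)"
    "\<And>v. G *v W v + transpose D *v U v = join (Gamma_mat G D b *v v) 0"
    using Gamma_lift[OF independent_if_dual_neg(1)[OF neg]] by metis
  have DW: "W v \<bullet> (transpose D *v u') = 0" if "supported_on b u'" for u' v
    using inner_transpose_eq_0[OF that] W(2) by blast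
  have 1: "W v \<bullet> (G *v W v') = v \<bullet> (Gamma_mat G D b *v v')" for v v'
    using arg_cong[OF W(4)[of v'], of "\<lambda>a. W v \<bullet> a"] DW[OF W(3)]
    by (simp add: inner_add_right inner_blocks[of _ "join _ _"] W(1))
  \<comment> \<open>Gamma is symmetric because its bilinear form is that of G evaluated on the lifts
    \<open>W v\<close>.\<close>
  have "transpose (Gamma_mat G D b) *v v = Gamma_mat G D b *v v" for v
  proof (rule vector_eq_rdot[THEN iffD1], intro allI)
    fix v' :: "real^'x"
    have "v' \<bullet> (transpose (Gamma_mat G D b) *v v) = W v \<bullet> (G *v W v')"
      by (simp add: inner_transpose_mult 1 inner_commute)
    also have "\<dots> = v' \<bullet> (Gamma_mat G D b *v v)"
      unfolding symmetric_inner[OF sym, of "W v" "W v'"] 1[symmetric] by (rule inner_commute)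
    finally show "(transpose (Gamma_mat G D b) *v v) \<bullet> v' = (Gamma_mat G D b *v v) \<bullet> v'"
      by (simp add: inner_commute)
  qed
  then have "transpose (Gamma_mat G D b) = Gamma_mat G D b"
    by (simp add: matrix_eq)
  moreover have "v \<bullet> (Gamma_mat G D b *v v) > 0" if "v \<noteq> 0" for v
  proof -
    define k where "k = matrix_inv G *v (transpose D *v U v)"
    have k: "G *v k = transpose D *v U v"
      by (simp add: k_def matrix_inv_apply[OF invertible_form])
    have c: "W v \<bullet> (G *v k) = 0" "k \<bullet> (G *v W v) = 0"
      using DW[OF W(3)] symmetric_inner[OF sym, of k "W v"] by (simp_all add: k inner_commute)
    have s: "(W v + k) \<bullet> (G *v (W v + k)) = v \<bullet> (Gamma_mat G D b *v v) + k \<bullet> (G *v k)"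
      by (simp add: matrix_vector_right_distrib inner_add 1 c)
    have y: "ypart (G *v (W v + k)) = 0"
      by (simp add: matrix_vector_right_distrib k W(4) del: parts_linear)
    show ?thesis
    proof (cases "U v = 0")
      case False
      then have "k \<bullet> (G *v k) < 0" using neg W(3) k by (auto simp: dual_neg_def)
      with form_nonneg[OF y] s show ?thesis by linarith
    next
      \<comment> \<open>Here k = 0, so strictness comes from \<open>form_pos\<close> applied to the
        nonzero vector \<open>W v\<close>.\<close>
      case True
      then have "k = 0" by (simp add: k_def)
      moreover have "W v \<noteq> 0" using W(1)[of v] that by auto
      ultimately show ?thesis using form_pos[of "W v + k"] y s by simp
    qed
  qed
  ultimately show ?thesis by (simp add: pos_definite_def)
qed

section \<open>The projection operators and adding one constraint\<close>

text \<open>Replaces the explicit formulas by the linear system they solve: d = H n and l = N^* n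
  satisfy G d + D^T l = n with d tangent. The inverse over \<open>a\<close> exists because u^T N^T
  G^-1 N u is the form at w = G^-1 N u, negative for u nonzero.\<close>

lemma Nstar_Hmat_apply:
  assumes neg: "dual_neg D a"
  shows "supported_on a (Nstar G D a *v n)"
    and "G *v (Hmat G D a *v n) = n - transpose D *v (Nstar G D a *v n)"
    and "\<And>i. i \<in> a \<Longrightarrow> D $ i \<bullet> (Hmat G D a *v n) = 0"
    and "\<And>l. supported_on a l \<Longrightarrow> Nstar G D a *v (transpose D *v l) = l"
proof -
  let ?N = "Nmat D a"
  define S where "S = transpose ?N ** matrix_inv G ** ?N"
  have Sv: "S *v u = sel_rows a D *v (matrix_inv G *v (?N *v u))" for u
    by (simp add: S_def Nmat_def matrix_vector_mul_assoc[symmetric])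
  have N: "?N *v u = transpose D *v u" if "supported_on a u" for u
    using transpose_sel_rows_mult[OF that] by (simp add: Nmat_def)
  have GG: "G *v (matrix_inv G *v v) = v" for v
    by (rule matrix_inv_apply[OF invertible_form])
  have Ssupp: "supported_on a (sel_rows a D *v w)" for w
    by (simp add: supported_on_def sel_rows_mult_nth)
  have S0: "S $ i $ j = 0" if "i \<notin> a \<or> j \<notin> a" for i j
  proof -
    have "S $ i $ j = (S *v axis j 1) $ i"
      by (simp add: matrix_vector_mult_basis column_def)
    also have "\<dots> = 0"
    proof (cases "i \<in> a")
      case True
      with that have "j \<notin> a" by simp
      then have "?N *v axis j 1 = 0"
        by (simp add: matrix_vector_mult_basis column_def Nmat_def transpose_def sel_rows_def vec_eq_iff)
      then show ?thesis by (simp add: Sv)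
    qed (simp add: Sv sel_rows_mult_nth)
    finally show ?thesis .
  qed
  have Sinj: "u = 0" if "supported_on a u" "S *v u = 0" for u
  proof (rule ccontr)
    assume "u \<noteq> 0"
    let ?w = "matrix_inv G *v (?N *v u)"
    have "?w \<bullet> (G *v ?w) = ?w \<bullet> (transpose (sel_rows a D) *v u)" by (simp add: GG Nmat_def)
    also have "\<dots> = (S *v u) \<bullet> u" by (simp add: inner_transpose_mult Sv)
    finally have "?w \<bullet> (G *v ?w) = 0" using that by simp
    moreover have "?w \<bullet> (G *v ?w) < 0"
      using neg that \<open>u \<noteq> 0\<close> by (auto simp: dual_neg_def GG N)
    ultimately show False by simp
  qed
  have inv: "supported_on a (inv_on a S *v v)" "S *v (inv_on a S *v v) = id_on a *v v"
    "inv_on a S *v (S *v v) = id_on a *v v" for v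
    by (rule inv_on_works; fact S0 Sinj)+
  have Ns: "Nstar G D a *v v = inv_on a S *v (sel_rows a D *v (matrix_inv G *v v))" for v
    by (simp add: Nstar_def Let_def S_def[symmetric] matrix_vector_mul_assoc[symmetric])
      (simp add: Nmat_def)
  show supp: "supported_on a (Nstar G D a *v n)" by (simp add: Ns inv)
  have H: "Hmat G D a *v n = matrix_inv G *v n - matrix_inv G *v (?N *v (Nstar G D a *v n))"
    by (simp add: Hmat_def Nstar_def Let_def matrix_vector_mult_diff_rdistrib
        matrix_vector_mul_assoc matrix_mul_assoc)
  show "G *v (Hmat G D a *v n) = n - transpose D *v (Nstar G D a *v n)"
    by (simp add: H matrix_vector_mult_diff_distrib GG N[OF supp])
  have "sel_rows a D *v (Hmat G D a *v n) = 0"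
    using inv(2)[of "sel_rows a D *v (matrix_inv G *v n)"]
    by (simp add: H matrix_vector_mult_diff_distrib Sv[symmetric] Ns
      id_on_mult_supported[OF Ssupp])
  then show "D $ i \<bullet> (Hmat G D a *v n) = 0" if "i \<in> a" for i
    using that sel_rows_mult_nth[of a D "Hmat G D a *v n" i] by simp
  show "Nstar G D a *v (transpose D *v l) = l" if "supported_on a l" for l
    using inv(3)[of l] by (simp add: Ns Sv N[OF that] id_on_mult_supported[OF that])
qed

text \<open>A Schur complement argument: w splits into a part k generated by the normals in
  \<open>a\<close> and a multiple of d = H n_p. They are G-orthogonal, and d^T G d = n_p^T H n_p <
  0.\<close>

lemma dual_neg_insert:
  assumes neg: "dual_neg D a" and "D $ p \<bullet> (Hmat G D a *v D $ p) < 0" "p \<notin> a"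
  shows "dual_neg D (insert p a)"
  unfolding dual_neg_def
proof (intro allI impI, elim conjE)
  fix w u assume u: "supported_on (insert p a) u" "u \<noteq> 0" and w: "G *v w = transpose D *v u"
  define d where "d = Hmat G D a *v D $ p"
  define r where "r = Nstar G D a *v D $ p"
  note dr = Nstar_Hmat_apply(1-3)[OF neg, where n = "D $ p", folded d_def r_def]
  \<comment> \<open>Since G d = n_p - D^T r, subtracting \<open>u $ p\<close> times d from w trades
    the normal n_p for r, leaving the multipliers v on \<open>a\<close>. This r has the opposite
    sign to \<open>dir_r\<close>.\<close>
  define v where "v = u - u $ p *\<^sub>R axis p 1 + u $ p *\<^sub>R r"
  define k where "k = w - u $ p *\<^sub>R d"
  have v: "supported_on a v"
    using u(1) dr(1) by (auto simp: supported_on_def v_def axis_def)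
  have ax: "transpose D *v axis p 1 = D $ p"
    by (simp add: matrix_vector_mult_basis column_def transpose_def vec_eq_iff)
  have k: "G *v k = transpose D *v v"
    by (simp add: k_def v_def matrix_vector_mult_diff_distrib matrix_vector_right_distrib
        matrix_vector_mult_scaleR w dr(2) ax algebra_simps)
  have c: "d \<bullet> (G *v k) = 0" "k \<bullet> (G *v d) = 0"
    using inner_transpose_eq_0[OF v, of D d] dr(3) symmetric_inner[OF sym, of k d]
    by (simp_all add: k inner_commute)
  have dd: "d \<bullet> (G *v d) < 0"
    using inner_transpose_eq_0[OF dr(1), of D d] dr(3) assms(2)[folded d_def]
    by (simp add: dr(2) inner_diff_right inner_commute[of d "D $ p"])
  have "w = k + u $ p *\<^sub>R d" by (simp add: k_def)
  then have e: "w \<bullet> (G *v w) = k \<bullet> (G *v k) + (u $ p)\<^sup>2 * (d \<bullet> (G *v d))"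
    by (simp add: matrix_vector_right_distrib matrix_vector_mult_scaleR inner_add c power2_eq_square)
  show "w \<bullet> (G *v w) < 0"
  proof (cases "v = 0")
    case False
    then have "k \<bullet> (G *v k) < 0" using neg v k by (auto simp: dual_neg_def)
    with dd e show ?thesis
      by (smt (verit) mult_nonneg_nonpos zero_le_power2)
  next
    case True
    have "u $ p \<noteq> 0"
    proof
      assume "u $ p = 0"
      with True have "u = 0" by (simp add: v_def)
      with u show False by simp
    qed
    moreover have "k \<bullet> (G *v k) = 0" using k True by simp
    ultimately show ?thesis using e dd by (simp add: mult_pos_neg)
  qed
qed

end

section \<open>Expansions along a step, feasible sets and the ratio test\<close>

lemma objective_add:
  assumes "transpose G = G"
  shows "objective G c (z + w) = objective G c z + gradient G c z \<bullet> w + 1/2 * (w \<bullet> (G *v w))"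
  using symmetric_inner[OF assms, of z w]
  by (simp add: objective_def gradient_def matrix_vector_right_distrib inner_add inner_commute
      field_simps)

lemma gradient_add: "gradient G c (z + w) = gradient G c z + G *v w"
  by (simp add: gradient_def matrix_vector_right_distrib)

lemma constr_add: "constr D h i (z + w) = constr D h i z + D $ i \<bullet> w"
  by (simp add: constr_def inner_add_right)

lemma continuous_on_join: "continuous_on S (\<lambda>y. join x y)"
  unfolding join_def
proof (intro continuous_on_vec_lambda)
  fix i show "continuous_on S (\<lambda>y. case i of Inl a \<Rightarrow> x $ a | Inr b \<Rightarrow> y $ b)"
    by (cases i) (auto intro: continuous_intros)
qed

lemma closed_feasible_y: "closed (feasible_y D h J x)"
proof -
  have "feasible_y D h J x = (\<Inter>i\<in>J. {y. constr D h i (join x y) \<le> 0})"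
    by (auto simp: feasible_y_def)
  also have "closed \<dots>"
    unfolding constr_def
    by (intro closed_INT ballI closed_Collect_le continuous_intros continuous_on_join)
  finally show ?thesis .
qed

lemma continuous_on_objective_join: "continuous_on S (\<lambda>y. objective G c (join x y))"
proof -
  have "continuous_on S (\<lambda>y. G *v join x y)"
    by (rule continuous_on_compose2[OF matrix_vector_mult_linear_continuous_on[of UNIV]
          continuous_on_join]) simp
  then show ?thesis
    unfolding objective_def by (intro continuous_intros continuous_on_join)
qed

lemma step_t1_ge_iff:
  "ereal t \<le> step_t1 G D p (z, a, u) \<longleftrightarrow>
     (\<forall>j\<in>a. dir_r G D p a $ j < 0 \<longrightarrow> t \<le> u $ j / dir_r G D p a $ j)"
  by (auto simp: step_t1_def Let_def)

lemma step_t1_attained: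
  "step_t1 G D p (z, a, u) = \<infinity> \<or>
     (\<exists>k\<in>a. dir_r G D p a $ k < 0 \<and> ereal (u $ k / dir_r G D p a $ k) = step_t1 G D p (z, a, u))"
proof -
  have "step_t1 G D p (z, a, u) \<in>
      insert \<infinity> ((\<lambda>j. ereal (u $ j / dir_r G D p a $ j)) ` {j\<in>a. dir_r G D p a $ j < 0})"
    unfolding step_t1_def Let_def prod.case by (rule Min_in) auto
  then show ?thesis by auto
qed

section \<open>First-order conditions and S-pairs\<close>

context saddle_form begin

lemma local_minimax_if_KKT:
  assumes ind: "independent_rows b (right_cols D)" and pos: "pos_definite (Gamma_mat G D b)"
    and act: "\<And>i. i \<in> b \<Longrightarrow> constr D h i z = 0"
    and l: "supported_on b l" "\<And>i. l $ i \<le> 0"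
    and kkt: "gradient G c z + transpose D *v l = 0"
  shows "local_minimax G c D h b (xpart z) (ypart z)"
proof -
  obtain W U L where W: "\<And>v. xpart (W v) = v" "\<And>v i. i \<in> b \<Longrightarrow> D $ i \<bullet> W v = 0"
    "\<And>v. supported_on b (U v)"
    "\<And>v. G *v W v + transpose D *v U v = join (Gamma_mat G D b *v v) 0"
    "\<And>v. norm (ypart (W v)) \<le> L * norm v"
    using Gamma_lift[OF ind] by metis
  \<comment> \<open>The radius covers the y-response of the lift; the absolute value keeps it
    nonnegative whatever the sign of \<open>L\<close>.\<close>
  define \<eta> where "\<eta> \<delta> = \<bar>L\<bar> * \<delta>" for \<delta> :: real
  have g: "gradient G c z \<bullet> w = - (\<Sum>i\<in>UNIV. l $ i * (D $ i \<bullet> w))" for w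
  proof -
    have "gradient G c z = - (transpose D *v l)" using kkt by (simp add: eq_neg_iff_add_eq_0)
    then show ?thesis by (simp add: transpose_mult_sum inner_sum_left)
  qed
  have upper: "objective G c (join (xpart z) y) \<le> objective G c z"
    if y: "y \<in> feasible_y D h b (xpart z)" for y
  proof -
    define w where "w = join (xpart z) y - z"
    have zw: "join (xpart z) y = z + w" by (simp add: w_def)
    have "0 \<le> l $ i * (D $ i \<bullet> w)" for i
    proof (cases "i \<in> b")
      case True
      with y act have "D $ i \<bullet> w \<le> 0" by (auto simp: feasible_y_def zw constr_add)
      with l(2) show ?thesis by (simp add: mult_nonpos_nonpos)
    next
      case False
      with l(1) show ?thesis by (simp add: supported_on_def)
    qed
    then have "gradient G c z \<bullet> w \<le> 0" by (simp add: g sum_nonneg)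
    moreover have "w \<bullet> (G *v w) \<le> 0" by (rule form_nonpos) (simp add: w_def)
    ultimately show ?thesis by (simp add: zw objective_add[OF sym])
  qed
  have lower: "\<exists>\<omega>\<in>feasible_y D h b x \<inter> cball (ypart z) (\<eta> \<delta>). objective G c z \<le> objective G c (join x \<omega>)"
    if x: "x \<in> cball (xpart z) \<delta>" for x \<delta>
  proof
    define w where "w = W (x - xpart z)"
    have zw: "join x (ypart (z + w)) = z + w"
      by (rule parts_eqI) (simp_all add: w_def W(1))
    have n: "norm (x - xpart z) \<le> \<delta>" using x by (simp add: dist_norm norm_minus_commute)
    have "norm (ypart w) \<le> L * norm (x - xpart z)" by (simp add: w_def W(5))
    also have "\<dots> \<le> \<bar>L\<bar> * \<delta>" using n by (intro mult_mono) auto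
    finally have "ypart (z + w) \<in> cball (ypart z) (\<eta> \<delta>)" by (simp add: dist_norm \<eta>_def)
    moreover have "ypart (z + w) \<in> feasible_y D h b x"
      using act W(2) unfolding feasible_y_def mem_Collect_eq zw by (simp add: constr_add w_def)
    ultimately show "ypart (z + w) \<in> feasible_y D h b x \<inter> cball (ypart z) (\<eta> \<delta>)" by blast
    have "l $ i * (D $ i \<bullet> w) = 0" for i
      using l(1) W(2) by (cases "i \<in> b") (auto simp: supported_on_def w_def)
    then have g0: "gradient G c z \<bullet> w = 0"
      by (simp only: g sum.neutral_const minus_zero)
    have "w \<bullet> (G *v w) = (x - xpart z) \<bullet> (Gamma_mat G D b *v (x - xpart z))"
      using arg_cong[OF W(4)[of "x - xpart z"], of "\<lambda>a. w \<bullet> a"] W(2)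
        inner_transpose_eq_0[OF W(3)[of "x - xpart z"], of D w]
      by (simp add: inner_add_right inner_blocks[of _ "join _ _"] W(1) w_def)
    also have "\<dots> \<ge> 0"
      using pos by (cases "x - xpart z = 0") (auto simp: pos_definite_def less_imp_le)
    finally show "objective G c z \<le> objective G c (join x (ypart (z + w)))"
      unfolding zw by (simp add: objective_add[OF sym] g0)
  qed
  have max: "\<exists>\<mu>. (\<exists>\<omega>\<in>feasible_y D h b x \<inter> cball (ypart z) (\<eta> \<delta>). \<mu> = objective G c (join x \<omega>)) \<and>
      (\<forall>\<omega>\<in>feasible_y D h b x \<inter> cball (ypart z) (\<eta> \<delta>). objective G c (join x \<omega>) \<le> \<mu>) \<and>
      objective G c z \<le> \<mu>"
    if x: "x \<in> cball (xpart z) \<delta>" for x \<delta>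
  proof -
    let ?F = "feasible_y D h b x \<inter> cball (ypart z) (\<eta> \<delta>)"
    \<comment> \<open>Compactness gives the existence of the maximum, and the lift shows that the
      set is nonempty.\<close>
    have "compact ?F"
      by (rule closed_Int_compact[OF closed_feasible_y compact_cball])
    moreover obtain \<omega>0 where \<omega>0: "\<omega>0 \<in> ?F" "objective G c z \<le> objective G c (join x \<omega>0)"
      using lower[OF x] by blast
    ultimately obtain \<omega> where "\<omega> \<in> ?F" "\<forall>y\<in>?F. objective G c (join x y) \<le> objective G c (join x \<omega>)"
      using continuous_attains_sup[of ?F "\<lambda>y. objective G c (join x y)"]
        continuous_on_objective_join[of ?F G c x] by blast
    with \<omega>0 show ?thesis by (blast intro: order_trans)
  qed
  have "(\<eta> \<longlongrightarrow> \<bar>L\<bar> * 0) (at_right 0)"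
    unfolding \<eta>_def by (intro tendsto_intros)
  then have lim: "(\<eta> \<longlongrightarrow> 0) (at_right 0)" by simp
  have "0 \<le> \<eta> \<delta>" if "\<delta> \<in> {0<..1}" for \<delta>
    using that by (simp add: \<eta>_def)
  moreover have "ypart z \<in> feasible_y D h b (xpart z)" using act by (simp add: feasible_y_def)
  moreover have "(0::real) < 1" by simp
  ultimately show ?thesis
    unfolding local_minimax_def join_parts using upper max lim by blast
qed

lemma S_pairI:
  assumes neg: "dual_neg D b"
    and act: "\<And>i. i \<in> b \<Longrightarrow> constr D h i z = 0"
    and l: "supported_on b l" "\<And>i. l $ i \<le> 0"
    and kkt: "gradient G c z + transpose D *v l = 0"
  shows "S_pair G c D h z b"
proof -
  note ind = independent_if_dual_neg[OF neg] and pos = Gamma_pos_if_dual_neg[OF neg]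
  have "(\<Sum>i\<in>b. l $ i *\<^sub>R D $ i) = transpose D *v l"
    unfolding transpose_mult_sum using l(1)
    by (intro sum.mono_neutral_left) (auto simp: supported_on_def)
  then have "\<exists>l. (\<forall>i\<in>b. l i \<le> 0) \<and> gradient G c z + (\<Sum>i\<in>b. l i *\<^sub>R D $ i) = 0"
    using l(2) kkt by (intro exI[of _ "\<lambda>i. l $ i"]) simp
  with local_minimax_if_KKT[OF ind(1) pos act l kkt] act ind pos show ?thesis
    by (simp add: S_pair_def)
qed

text \<open>\<open>Nstar\<close> is a left inverse of N on vectors supported on \<open>a\<close>, so
  applying it to the stationarity equation recovers the given multipliers.\<close>

lemma S_pair_multipliers:
  fixes D :: "real^('x + 'y)^('m::finite)"
  assumes S: "S_pair G c D h z a"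
  defines "l \<equiv> - (Nstar G D a *v gradient G c z)"
  shows "dual_neg D a" "supported_on a l" "\<And>i. l $ i \<le> 0"
    "gradient G c z + transpose D *v l = 0"
proof -
  show neg: "dual_neg D a"
    using S dual_neg_if_Gamma_pos by (auto simp: S_pair_def)
  obtain m where m: "\<And>i. i \<in> a \<Longrightarrow> m i \<le> 0" "gradient G c z + (\<Sum>i\<in>a. m i *\<^sub>R D $ i) = 0"
    using S by (auto simp: S_pair_def)
  define k :: "real^'m" where "k = (\<chi> i. if i \<in> a then m i else 0)"
  have k: "supported_on a k" by (simp add: k_def supported_on_def)
  have "transpose D *v k = (\<Sum>i\<in>a. m i *\<^sub>R D $ i)"
    unfolding transpose_mult_sum by (intro sum.mono_neutral_cong_right) (auto simp: k_def)
  with m have kkt: "gradient G c z + transpose D *v k = 0" by simp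
  then have "gradient G c z = - (transpose D *v k)" by (simp add: eq_neg_iff_add_eq_0)
  then have "l = k"
    by (simp add: l_def matrix_mult_uminus Nstar_Hmat_apply(4)[OF neg k])
  with k kkt m show "supported_on a l" "\<And>i. l $ i \<le> 0" "gradient G c z + transpose D *v l = 0"
    by (auto simp: k_def)
qed

section \<open>Invariant and progress of the step procedure\<close>

text \<open>The vector G d is the combination of normals with coefficients r and 1 at
  \<open>p\<close>. It pairs with the tangent vector d to d^T n_p, and dual negativity applies
  because the coefficient at \<open>p\<close> is nonzero.\<close>

lemma dir_props:
  assumes neg: "dual_neg D (insert p a)" and p: "p \<notin> a"
  shows "supported_on a (dir_r G D p a)"
    and "G *v dir_z G D p a = transpose D *v (dir_r G D p a + axis p 1)"
    and "\<And>i. i \<in> a \<Longrightarrow> D $ i \<bullet> dir_z G D p a = 0"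
    and "dir_z G D p a \<bullet> (G *v dir_z G D p a) = dir_z G D p a \<bullet> D $ p"
    and "dir_z G D p a \<bullet> D $ p < 0"
proof -
  let ?d = "dir_z G D p a" and ?r = "dir_r G D p a"
  have nega: "dual_neg D a" using neg by (rule dual_neg_mono) auto
  note * = Nstar_Hmat_apply(1-3)[OF nega, where n = "D $ p"]
  show r: "supported_on a ?r"
    using *(1) by (simp add: dir_r_def supported_on_def)
  have ax: "transpose D *v axis p 1 = D $ p"
    by (simp add: matrix_vector_mult_basis column_def transpose_def vec_eq_iff)
  show Gd: "G *v ?d = transpose D *v (?r + axis p 1)"
    by (simp add: dir_z_def dir_r_def *(2) matrix_vector_right_distrib
        matrix_vector_mult_diff_distrib matrix_mult_uminus ax)
  show d: "D $ i \<bullet> ?d = 0" if "i \<in> a" for i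
    using *(3)[OF that] by (simp add: dir_z_def)
  show e: "?d \<bullet> (G *v ?d) = ?d \<bullet> D $ p"
    using inner_transpose_eq_0[OF r, of D ?d] d
    by (simp add: Gd matrix_vector_right_distrib ax inner_add_right)
  have "supported_on (insert p a) (?r + axis p 1)"
    using r by (auto simp: supported_on_def axis_def)
  moreover have "(?r + axis p 1) $ p \<noteq> 0"
    using r p by (simp add: supported_on_def axis_def)
  then have "?r + axis p 1 \<noteq> 0" by (metis zero_index)
  ultimately have "?d \<bullet> (G *v ?d) < 0"
    using neg Gd unfolding dual_neg_def by blast
  with e show "?d \<bullet> D $ p < 0" by simp
qed

text \<open>\<open>A\<close> and \<open>f\<close> remember the initial working set and objective
  value. Unlike in an S-pair, \<open>p\<close> may already carry a multiplier while its constraint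
  is still violated.\<close>

definition step_inv ::
  "real^('x + 'y) \<Rightarrow> real^('x + 'y)^('m::finite) \<Rightarrow> real^'m \<Rightarrow> 'm \<Rightarrow> 'm set \<Rightarrow> real
    \<Rightarrow> ('x + 'y, 'm) state \<Rightarrow> bool" where
  "step_inv c D h p A f = (\<lambda>(z, a, u). a \<subseteq> A \<and> supported_on (insert p a) u \<and>
     (\<forall>i. u $ i \<le> 0) \<and> gradient G c z + transpose D *v u = 0 \<and>
     (\<forall>i\<in>a. constr D h i z = 0) \<and> constr D h p z > 0 \<and> objective G c z \<le> f)"

text \<open>The gradient changes by t G d and the normal combination by -t D^T (r + e_p); these
  cancel. It serves partial and full steps alike, as only t at most t1 is assumed.\<close>

lemma step_advance:
  assumes inv: "step_inv c D h p A f (z, a, u)"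
    and neg: "dual_neg D (insert p A)" and p: "p \<notin> A"
    and t: "0 \<le> t" "ereal t \<le> step_t1 G D p (z, a, u)"
  defines "z' \<equiv> z + t *\<^sub>R dir_z G D p a" and "u' \<equiv> u - t *\<^sub>R (dir_r G D p a + axis p 1)"
  shows "supported_on (insert p a) u'" "\<And>i. u' $ i \<le> 0"
    "gradient G c z' + transpose D *v u' = 0" "\<And>i. i \<in> a \<Longrightarrow> constr D h i z' = 0"
    "constr D h p z' = constr D h p z + t * (dir_z G D p a \<bullet> D $ p)"
    "objective G c z' \<le> objective G c z" "0 < t \<Longrightarrow> objective G c z' < objective G c z"
proof -
  let ?d = "dir_z G D p a" and ?r = "dir_r G D p a"
  have a: "a \<subseteq> A" and u: "supported_on (insert p a) u" "\<And>i. u $ i \<le> 0"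
    and kkt: "gradient G c z + transpose D *v u = 0"
    and act: "\<And>i. i \<in> a \<Longrightarrow> constr D h i z = 0"
    using inv by (auto simp: step_inv_def)
  have pa: "p \<notin> a" using a p by auto
  have "dual_neg D (insert p a)" using neg by (rule dual_neg_mono) (use a in auto)
  note dir = dir_props[OF this pa]
  show "supported_on (insert p a) u'"
    using u(1) dir(1) by (auto simp: u'_def supported_on_def axis_def)
  show "u' $ i \<le> 0" for i
  proof -
    consider "i = p" | "i \<in> a" "i \<noteq> p" | "i \<notin> insert p a" by auto
    then show ?thesis
    proof cases
      case 1
      then show ?thesis using dir(1) pa u(2)[of p] t(1) by (simp add: u'_def supported_on_def axis_def)
    next
      case 2
      \<comment> \<open>A nonnegative entry of r only lowers the multiplier; a negative one is
        controlled by the ratio test.\<close>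
      have "u $ i - t * ?r $ i \<le> 0"
      proof (cases "?r $ i < 0")
        case True
        then have "t \<le> u $ i / ?r $ i" using t(2) 2 unfolding step_t1_ge_iff by blast
        with True show ?thesis by (simp add: neg_le_divide_eq)
      next
        case False
        with t(1) have "0 \<le> t * ?r $ i" by simp
        with u(2)[of i] show ?thesis by linarith
      qed
      with 2 show ?thesis by (simp add: u'_def axis_def)
    next
      case 3
      then show ?thesis using u(1) dir(1) by (auto simp: u'_def supported_on_def axis_def)
    qed
  qed
  show "gradient G c z' + transpose D *v u' = 0"
    using kkt by (simp add: z'_def u'_def gradient_add matrix_vector_mult_diff_distrib
      matrix_vector_mult_scaleR dir(2))
  show "constr D h i z' = 0" if "i \<in> a" for i
    using that act dir(3) by (simp add: z'_def constr_add)
  show "constr D h p z' = constr D h p z + t * (?d \<bullet> D $ p)"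
    by (simp add: z'_def constr_add inner_commute)
  \<comment> \<open>By stationarity the slope is a sum over multipliers, and tangency of d leaves
    only the one of \<open>p\<close>.\<close>
  have g: "gradient G c z \<bullet> ?d = - (u $ p * (?d \<bullet> D $ p))"
  proof -
    have "gradient G c z = - (transpose D *v u)" using kkt by (simp add: eq_neg_iff_add_eq_0)
    then have "gradient G c z \<bullet> ?d = - (\<Sum>i\<in>UNIV. u $ i * (D $ i \<bullet> ?d))"
      by (simp add: transpose_mult_sum inner_sum_left)
    also have "(\<Sum>i\<in>UNIV. u $ i * (D $ i \<bullet> ?d)) = (\<Sum>i\<in>{p}. u $ i * (D $ i \<bullet> ?d))"
      using u(1) dir(3) by (intro sum.mono_neutral_right) (auto simp: supported_on_def)
    finally show ?thesis by (simp add: inner_commute)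
  qed
  \<comment> \<open>The quadratic term merges with the linear one because d^T G d = d^T n_p; the
    last factor is positive for t > 0, as the multiplier of \<open>p\<close> is nonpositive.\<close>
  have f: "objective G c z' = objective G c z + t * (?d \<bullet> D $ p) * (t / 2 - u $ p)"
    by (simp add: z'_def objective_add[OF sym] g matrix_vector_mult_scaleR dir(4) algebra_simps)
  show "objective G c z' < objective G c z" if "0 < t"
  proof -
    have "t * (?d \<bullet> D $ p) * (t / 2 - u $ p) < 0"
      using that dir(5) u(2)[of p] by (intro mult_neg_pos mult_pos_neg) auto
    with f show ?thesis by simp
  qed
  then show "objective G c z' \<le> objective G c z"
    using t(1) f by (cases "t = 0") auto
qed

lemma step_t1_nonneg:
  assumes "step_inv c D h p A f (z, a, u)"
  shows "0 \<le> step_t1 G D p (z, a, u)"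
  using assms step_t1_ge_iff[of 0 G D p z a u]
  by (auto simp: step_inv_def zero_ereal_def[symmetric] intro: divide_nonpos_neg)

lemma step_t2_eq:
  assumes inv: "step_inv c D h p A f (z, a, u)"
    and neg: "dual_neg D (insert p A)" and p: "p \<notin> A"
  obtains t where "0 < t" "step_t2 G D h p (z, a, u) = ereal t"
    "constr D h p z + t * (dir_z G D p a \<bullet> D $ p) = 0" "dir_z G D p a \<bullet> D $ p < 0"
proof -
  have a: "a \<subseteq> A" and s: "constr D h p z > 0"
    using inv by (auto simp: step_inv_def)
  have "dual_neg D (insert p a)" using neg by (rule dual_neg_mono) (use a in auto)
  then have d: "dir_z G D p a \<bullet> D $ p < 0" by (rule dir_props(5)) (use a p in auto)
  show thesis
    by (rule that[of "- constr D h p z / (dir_z G D p a \<bullet> D $ p)"])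
      (use d s in \<open>auto simp: step_t2_def intro: divide_pos_neg\<close>)
qed

text \<open>Here t = t1 < t2, so \<open>p\<close> stays violated, and the ratio at \<open>k\<close>
  makes its multiplier exactly zero, so \<open>k\<close> can leave the support.\<close>

lemma partial_step_inv:
  assumes inv: "step_inv c D h p A f st"
    and neg: "dual_neg D (insert p A)" and p: "p \<notin> A"
    and step: "partial_step G D h p st st'"
  shows "step_inv c D h p A f st' \<and> card (fst (snd st)) = Suc (card (fst (snd st')))"
proof -
  obtain z a u where st: "st = (z, a, u)" by (cases st)
  obtain z' a' u' where st': "st' = (z', a', u')" by (cases st')
  obtain t k where t: "ereal t = min (step_t1 G D p (z, a, u)) (step_t2 G D h p (z, a, u))"
      "ereal t \<noteq> step_t2 G D h p (z, a, u)"
    and k: "k \<in> a" "dir_r G D p a $ k < 0"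
      "ereal (u $ k / dir_r G D p a $ k) = step_t1 G D p (z, a, u)"
    and z': "z' = z + t *\<^sub>R dir_z G D p a" and a': "a' = a - {k}"
    and u': "u' = (\<chi> j. if j = k then 0 else (u - t *\<^sub>R (dir_r G D p a + axis p 1)) $ j)"
    using step by (auto simp: partial_step_def st st')
  note inv = inv[unfolded st]
  obtain s where s: "0 < s" "step_t2 G D h p (z, a, u) = ereal s"
    "constr D h p z + s * (dir_z G D p a \<bullet> D $ p) = 0" "dir_z G D p a \<bullet> D $ p < 0"
    using step_t2_eq[OF inv neg p] .
  have a: "a \<subseteq> A" and f: "objective G c z \<le> f" using inv by (auto simp: step_inv_def)
  have "ereal t \<le> ereal s" using t(1) s(2) by simp
  with t(2) s(2) have ts: "t < s" by auto
  have t1: "ereal t = step_t1 G D p (z, a, u)"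
    using t by (auto simp: min_def split: if_splits)
  have t0: "0 \<le> t" using step_t1_nonneg[OF inv] by (simp add: t1[symmetric])
  note adv = step_advance[OF inv neg p t0 eq_refl[OF t1], folded z']
  have tk: "t = u $ k / dir_r G D p a $ k" using t1 k(3) by (metis ereal.inject)
  have kp: "k \<noteq> p" using k a p by auto
  \<comment> \<open>Deleting entry \<open>k\<close> changes nothing, since t is its own
    ratio.\<close>
  have uu: "u' = u - t *\<^sub>R (dir_r G D p a + axis p 1)"
    using k(2) kp by (auto simp: u' vec_eq_iff tk axis_def)
  have "u' $ k = 0" by (simp add: u')
  then have "supported_on (insert p a') u'"
    using adv(1) by (auto simp: uu[symmetric] a' supported_on_def)
  moreover have "constr D h p z' > 0"
  proof -
    have "s * (dir_z G D p a \<bullet> D $ p) < t * (dir_z G D p a \<bullet> D $ p)"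
      using ts s(4) by (rule mult_strict_right_mono_neg)
    with s(3) adv(5) show ?thesis by linarith
  qed
  ultimately have "step_inv c D h p A f st'"
    using adv(2-4,6) a f by (auto simp: step_inv_def st' a' uu[symmetric])
  moreover have "card a = Suc (card a')"
    unfolding a' by (rule card.remove) (use k(1) in auto)
  ultimately show ?thesis by (simp add: st st')
qed

lemma partial_steps_inv:
  assumes inv: "step_inv c D h p A f st"
    and neg: "dual_neg D (insert p A)" and p: "p \<notin> A"
    and steps: "(partial_step G D h p ^^ n) st st'"
  shows "step_inv c D h p A f st' \<and> card (fst (snd st)) = n + card (fst (snd st'))"
  using steps
proof (induction n arbitrary: st')
  case 0
  with inv show ?case by simp
next
  case (Suc n)
  then obtain y where y: "(partial_step G D h p ^^ n) st y" "partial_step G D h p y st'"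
    by auto
  with Suc.IH[OF y(1)] partial_step_inv[OF _ neg p y(2)] show ?case by auto
qed

lemma full_step_S_pair:
  assumes inv: "step_inv c D h p A f (z, a, u)"
    and neg: "dual_neg D (insert p A)" and p: "p \<notin> A"
    and stuck: "\<nexists>st'. partial_step G D h p (z, a, u) st'"
  shows "\<exists>z'. full_step G D h p (z, a, u) (z', insert p a) \<and>
    S_pair G c D h z' (insert p a) \<and> objective G c z' < f"
proof -
  obtain s where s: "0 < s" "step_t2 G D h p (z, a, u) = ereal s"
    "constr D h p z + s * (dir_z G D p a \<bullet> D $ p) = 0" "dir_z G D p a \<bullet> D $ p < 0"
    using step_t2_eq[OF inv neg p] .
  have a: "a \<subseteq> A" and f: "objective G c z \<le> f" using inv by (auto simp: step_inv_def)
  \<comment> \<open>Otherwise the minimising index would allow a partial step. A tie between t1 and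
    t2 counts as a full step.\<close>
  have st1: "ereal s \<le> step_t1 G D p (z, a, u)"
  proof (rule ccontr)
    assume less: "\<not> ereal s \<le> step_t1 G D p (z, a, u)"
    then obtain k where k: "k \<in> a" "dir_r G D p a $ k < 0"
      "ereal (u $ k / dir_r G D p a $ k) = step_t1 G D p (z, a, u)"
      using step_t1_attained[of G D p z a u] by auto
    have "partial_step G D h p (z, a, u)
      (z + (u $ k / dir_r G D p a $ k) *\<^sub>R dir_z G D p a, a - {k},
       \<chi> j. if j = k then 0
            else (u - (u $ k / dir_r G D p a $ k) *\<^sub>R (dir_r G D p a + axis p 1)) $ j)"
      unfolding partial_step_def prod.case
      by (rule exI[of _ "u $ k / dir_r G D p a $ k"], rule exI[of _ k])
        (use k less s(2) in \<open>auto simp: min_def\<close>)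
    with stuck show False by blast
  qed
  define z' where "z' = z + s *\<^sub>R dir_z G D p a"
  note adv = step_advance[OF inv neg p less_imp_le[OF s(1)] st1, folded z'_def]
  have "full_step G D h p (z, a, u) (z', insert p a)"
    using st1 s(2) by (auto simp: full_step_def z'_def min_def)
  moreover have "S_pair G c D h z' (insert p a)"
  proof (rule S_pairI[OF _ _ adv(1-3)])
    show "dual_neg D (insert p a)" using neg by (rule dual_neg_mono) (use a in auto)
    show "constr D h i z' = 0" if "i \<in> insert p a" for i
      using that adv(4,5) s(3) by auto
  qed
  \<comment> \<open>Partial steps may have length zero; the strict decrease comes from the positive
    length of the full step.\<close>
  moreover have "objective G c z' < f" using adv(7)[OF s(1)] f by simp
  ultimately show ?thesis by blast
qed

end

section \<open>Termination and outcome of every run\<close>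

text \<open>Ties for t1 make partial steps a relation, so the claim covers every run: the first
  conjunct is termination, the second shows that a run out of partial steps ends in a full step
  rather than with t infinite.\<close>

theorem theorem4:
  fixes G :: "real^('x::finite + 'y::finite)^('x + 'y)"
    and c :: "real^('x + 'y)"
    and D :: "real^('x + 'y)^('m::finite)"
    and h :: "real^'m"
    and z :: "real^('x + 'y)"
    and \<alpha> :: "'m set"
    and p :: 'm
  assumes "transpose G = G"
    and "neg_definite (blk22 G)"
    and "pos_definite (blk11 G - blk12 G ** matrix_inv (blk22 G) ** transpose (blk12 G))"
    and "S_pair G c D h z \<alpha>"
    and "p \<in> neg_curv G D - \<alpha>"
    and "D $ p \<bullet> (Hmat G D \<alpha> *v D $ p) < 0"
    and "constr D h p z > 0"
  shows "(\<nexists>\<sigma>. \<sigma> 0 = start_state G c D z \<alpha> \<and>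
            (\<forall>i::nat. partial_step G D h p (\<sigma> i) (\<sigma> (Suc i)))) \<and>
         (\<forall>n st. (partial_step G D h p ^^ n) (start_state G c D z \<alpha>) st \<and>
            (\<nexists>st'. partial_step G D h p st st') \<longrightarrow>
            (\<exists>zb \<alpha>b. full_step G D h p st (zb, insert p \<alpha>b) \<and>
               \<alpha>b \<subseteq> \<alpha> \<and>
               n = card \<alpha> - card \<alpha>b \<and>
               S_pair G c D h zb (insert p \<alpha>b) \<and>
               objective G c zb < objective G c z))"
proof -
  interpret saddle_form G by unfold_locales (use assms in auto)
  let ?u = "- (Nstar G D \<alpha> *v gradient G c z)"
  note S = S_pair_multipliers[OF assms(4)]
  have p: "p \<notin> \<alpha>" using assms(5) by simp
  \<comment> \<open>The curvature hypothesis enters here, once for the initial set; monotonicity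
    carries it to all later working sets.\<close>
  have neg: "dual_neg D (insert p \<alpha>)" by (rule dual_neg_insert[OF S(1) assms(6) p])
  have "supported_on (insert p \<alpha>) ?u" using S(2) by (simp add: supported_on_def)
  then have inv: "step_inv c D h p \<alpha> (objective G c z) (start_state G c D z \<alpha>)"
    using S(3,4) assms(4,7) by (simp add: step_inv_def start_state_def S_pair_def)
  have start: "fst (snd (start_state G c D z \<alpha>)) = \<alpha>" by (simp add: start_state_def)
  show ?thesis
  proof (intro conjI notI allI impI)
    assume "\<exists>\<sigma>. \<sigma> 0 = start_state G c D z \<alpha> \<and> (\<forall>i. partial_step G D h p (\<sigma> i) (\<sigma> (Suc i)))"
    then obtain \<sigma> where \<sigma>: "\<sigma> 0 = start_state G c D z \<alpha>"
      "\<And>i. partial_step G D h p (\<sigma> i) (\<sigma> (Suc i))" by blast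
    have "(partial_step G D h p ^^ n) (start_state G c D z \<alpha>) (\<sigma> n)" for n
      by (induction n) (use \<sigma> in auto)
    \<comment> \<open>Each partial step removes one index, so there cannot be one more step than
      initial indices.\<close>
    from partial_steps_inv[OF inv neg p this, of "Suc (card \<alpha>)"] show False
      by (simp add: start)
  next
    fix n st
    assume n: "(partial_step G D h p ^^ n) (start_state G c D z \<alpha>) st \<and>
      (\<nexists>st'. partial_step G D h p st st')"
    obtain z' a u where st: "st = (z', a, u)" by (cases st)
    have inv': "step_inv c D h p \<alpha> (objective G c z) (z', a, u)" and "card \<alpha> = n + card a"
      using partial_steps_inv[OF inv neg p conjunct1[OF n]] by (auto simp: start st)
    moreover have "a \<subseteq> \<alpha>" using inv' by (simp add: step_inv_def)
    moreover obtain zb where "full_step G D h p (z', a, u) (zb, insert p a)"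
      "S_pair G c D h zb (insert p a)" "objective G c zb < objective G c z"
      using full_step_S_pair[OF inv' neg p] n by (auto simp: st)
    ultimately show "\<exists>zb \<alpha>b. full_step G D h p st (zb, insert p \<alpha>b) \<and> \<alpha>b \<subseteq> \<alpha> \<and>
        n = card \<alpha> - card \<alpha>b \<and> S_pair G c D h zb (insert p \<alpha>b) \<and>
        objective G c zb < objective G c z"
      unfolding st by (intro exI[of _ zb] exI[of _ a]) simp
  qed
qed

end
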